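(* Every profinite group of finite semisimple length is profinitely rigid.
   Context: A profinite group is semisimple if it is (topologically isomorphic to) a Cartesian product of finite nonabelian simple groups. A profinite group $G$ has finite semisimple length if there is a finite series $1=G_n\trianglelefteq\cdots\trianglelefteq G_1\trianglelefteq G_0=G$ of closed subgroups with every quotient $G_i/G_{i+1}$ semisimple. A profinite group $G$ is profinitely rigid if its underlying abstract group admits exactly one topology making it a profinite group. *)

theory Defs
  imports "HOL-Analysis.Analysis" "HOL-Algebra.Algebra"
begin

definition topological_group :: "('g, 'c) monoid_scheme \<Rightarrow> 'g topology \<Rightarrow> bool" where
  "topological_group G T \<longleftrightarrow>
     group G \<and> topspace T = carrier G \<and>
     continuous_map (prod_topology T T) T (\<lambda>(x, y). x \<otimes>\<^bsub>G\<^esub> y) \<and>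
     continuous_map T T (\<lambda>x. inv\<^bsub>G\<^esub> x)"

definition totally_disconnected_space :: "'a topology \<Rightarrow> bool" where
  "totally_disconnected_space T \<longleftrightarrow>
     (\<forall>S. connectedin T S \<longrightarrow> (\<exists>a. S \<subseteq> {a}))"

definition profinite_group :: "('g, 'c) monoid_scheme \<Rightarrow> 'g topology \<Rightarrow> bool" where
  "profinite_group G T \<longleftrightarrow>
     topological_group G T \<and> compact_space T \<and> Hausdorff_space T \<and>
     totally_disconnected_space T"

text \<open>Quotient topology on the coset space \<open>rcosets N\<close> of \<open>Y\<close> (projection \<open>x \<mapsto> N x\<close>):
a set of cosets is open iff its union (= preimage under the projection) is open.\<close>
definition coset_quotient_topology ::
  "('g, 'c) monoid_scheme \<Rightarrow> 'g set \<Rightarrow> 'g topology \<Rightarrow> 'g set topology" where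
  "coset_quotient_topology G N Y =
     topology (\<lambda>U. U \<subseteq> RCOSETS G N \<and> openin Y (\<Union>U))"

text \<open>Semisimple profinite group: topologically isomorphic to a Cartesian product
(with the product topology of discrete finite groups) of finite nonabelian simple groups.
The index set is taken inside the element type (possible since each factor has at least two
elements), and each finite factor is represented with carrier in \<open>nat\<close>.\<close>
definition semisimple_profinite :: "('g, 'c) monoid_scheme \<Rightarrow> 'g topology \<Rightarrow> bool" where
  "semisimple_profinite G T \<longleftrightarrow>
     (\<exists>(I :: 'g set) (H :: 'g \<Rightarrow> nat monoid) f.
        (\<forall>i\<in>I. simple_group (H i) \<and> finite (carrier (H i)) \<and> \<not> comm_group (H i)) \<and>
        f \<in> iso G (product_group I H) \<and>
        homeomorphic_map T (product_topology (\<lambda>i. discrete_topology (carrier (H i))) I) f)"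

definition finite_semisimple_length :: "('g, 'c) monoid_scheme \<Rightarrow> 'g topology \<Rightarrow> bool" where
  "finite_semisimple_length G T \<longleftrightarrow>
     (\<exists>(n :: nat) (S :: nat \<Rightarrow> 'g set).
        S 0 = carrier G \<and> S n = {\<one>\<^bsub>G\<^esub>} \<and>
        (\<forall>i\<le>n. subgroup (S i) G \<and> closedin T (S i)) \<and>
        (\<forall>i<n. S (Suc i) \<lhd> (G\<lparr>carrier := S i\<rparr>) \<and>
               semisimple_profinite ((G\<lparr>carrier := S i\<rparr>) Mod (S (Suc i)))
                 (coset_quotient_topology (G\<lparr>carrier := S i\<rparr>) (S (Suc i))
                    (subtopology T (S i)))))"

definition profinitely_rigid :: "('g, 'c) monoid_scheme \<Rightarrow> bool" where
  "profinitely_rigid G \<longleftrightarrow> (\<exists>!T. profinite_group G T)"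

end

theory Submission
  imports Defs
begin

text \<open>
Call a finite perfect subnormal subgroup a component; this notion does not refer to a topology.
In any profinite topology the centralizer of a component \<open>Q\<close> is open: an open normal subgroup \<open>U\<close>
with \<open>U \<inter> Q = 1\<close> centralizes \<open>Q\<close>, by the three subgroups lemma along a subnormal series of \<open>Q\<close>.
If the group has finite semisimple length, these centralizers intersect trivially, because a
nontrivial normal subgroup of a product of nonabelian simple groups contains one of the factors.
So the cosets of these centralizers are sets that are clopen in every profinite topology and
separate points, and a compact topology is determined by such a family.
\<close>

section \<open>Centralizers and components\<close>

definition centralizer :: "('g, 'c) monoid_scheme \<Rightarrow> 'g set \<Rightarrow> 'g set" where
  "centralizer G A = {x \<in> carrier G. \<forall>a\<in>A. x \<otimes>\<^bsub>G\<^esub> a = a \<otimes>\<^bsub>G\<^esub> x}"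

inductive subnormal :: "('g, 'c) monoid_scheme \<Rightarrow> 'g set \<Rightarrow> bool" for G where
  subnormal_self: "subnormal G (carrier G)"
| subnormal_step: "subnormal G K \<Longrightarrow> H \<lhd> G\<lparr>carrier := K\<rparr> \<Longrightarrow> subnormal G H"

text \<open>Weaker than the usual notion of component: quasisimplicity is not demanded, and the
  trivial subgroup qualifies. Perfectness is what the three subgroups argument uses.\<close>

definition group_components :: "('g, 'c) monoid_scheme \<Rightarrow> 'g set set" where
  "group_components G = {Q. subnormal G Q \<and> finite Q \<and> derived G Q = Q}"

context group
begin

section \<open>Commutation and centralizer subgroups\<close>

lemma inv_mult_cancel_left [simp]:
  "\<lbrakk>x \<in> carrier G; y \<in> carrier G\<rbrakk> \<Longrightarrow> inv x \<otimes> (x \<otimes> y) = y"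
  "\<lbrakk>x \<in> carrier G; y \<in> carrier G\<rbrakk> \<Longrightarrow> x \<otimes> (inv x \<otimes> y) = y"
  by (simp_all flip: m_assoc)

lemma commute_iff_conj:
  assumes "x \<in> carrier G" "y \<in> carrier G"
  shows "x \<otimes> y = y \<otimes> x \<longleftrightarrow> x \<otimes> y \<otimes> inv x = y"
  using assms by (metis inv_solve_right m_closed)

lemma commute_iff_commutator:
  assumes "x \<in> carrier G" "y \<in> carrier G"
  shows "x \<otimes> y = y \<otimes> x \<longleftrightarrow> x \<otimes> y \<otimes> inv x \<otimes> inv y = \<one>"
  using assms inv_solve_right[of \<one> "x \<otimes> y \<otimes> inv x" y] by (auto simp: commute_iff_conj)

lemma centralizer_subgroup:
  assumes "A \<subseteq> carrier G"
  shows "subgroup (centralizer G A) G"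
proof (rule subgroupI)
  show "centralizer G A \<noteq> {}"
    using assms by (auto simp: centralizer_def intro!: exI[of _ \<one>])
next
  fix x assume x: "x \<in> centralizer G A"
  have "inv x \<otimes> a = a \<otimes> inv x" if "a \<in> A" for a
  proof -
    have xa: "x \<in> carrier G" "a \<in> carrier G" "a \<otimes> x = x \<otimes> a"
      using x that assms by (auto simp: centralizer_def)
    have "inv x \<otimes> a = inv x \<otimes> (a \<otimes> x) \<otimes> inv x" using xa(1,2) by (simp add: m_assoc)
    also have "\<dots> = a \<otimes> inv x" unfolding xa(3) using xa(1,2) by (simp add: m_assoc)
    finally show ?thesis .
  qed
  then show "inv x \<in> centralizer G A"
    using x by (auto simp: centralizer_def)
next
  fix x y assume xy: "x \<in> centralizer G A" "y \<in> centralizer G A"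
  have "x \<otimes> y \<otimes> a = a \<otimes> (x \<otimes> y)" if "a \<in> A" for a
  proof -
    have c: "x \<in> carrier G" "y \<in> carrier G" "a \<in> carrier G" "x \<otimes> a = a \<otimes> x" "y \<otimes> a = a \<otimes> y"
      using xy that assms by (auto simp: centralizer_def)
    have "x \<otimes> y \<otimes> a = x \<otimes> a \<otimes> y" using c(1-3) by (simp add: m_assoc c(5))
    then show ?thesis using c(1-3) by (simp add: m_assoc c(4))
  qed
  then show "x \<otimes> y \<in> centralizer G A"
    using xy by (simp add: centralizer_def)
qed (auto simp: centralizer_def)

text \<open>Lets normality inside \<open>K\<close> be checked with the operations of
  \<open>G\<close> itself, the form in which subnormal steps are used below.\<close>

lemma normal_restrict_iff:
  assumes "subgroup K G"
  shows "H \<lhd> G\<lparr>carrier := K\<rparr> \<longleftrightarrow>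
    subgroup H G \<and> H \<subseteq> K \<and> (\<forall>k\<in>K. \<forall>h\<in>H. k \<otimes> h \<otimes> inv k \<in> H)"
proof -
  interpret K: group "G\<lparr>carrier := K\<rparr>" using assms by (rule subgroup_imp_group)
  have "subgroup H (G\<lparr>carrier := K\<rparr>) \<longleftrightarrow> subgroup H G \<and> H \<subseteq> K"
    using incl_subgroup[OF assms] subgroup_incl[OF _ assms]
      subgroup.subset[of H "G\<lparr>carrier := K\<rparr>"] by auto
  then show ?thesis
    using m_inv_consistent[OF assms] by (simp add: K.normal_inv_iff)
qed

section \<open>Conjugates of subnormal subgroups and components\<close>

lemma subnormal_subgroup: "subnormal G H \<Longrightarrow> subgroup H G"
  by (induction rule: subnormal.induct) (auto simp: subgroup_self normal_restrict_iff)

lemma conj_hom: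
  assumes "g \<in> carrier G"
  shows "(\<lambda>h. g \<otimes> h \<otimes> inv g) \<in> hom G G"
  using assms by (auto simp: hom_def m_assoc)

lemma inj_on_conj:
  assumes "g \<in> carrier G" "H \<subseteq> carrier G"
  shows "inj_on (\<lambda>h. g \<otimes> h \<otimes> inv g) H"
  using assms by (auto simp: inj_on_def subset_iff)

text \<open>Conjugation by \<open>g\<close> maps \<open>G\<close> onto itself and restricts to an
  isomorphism of each \<open>K\<close> onto its image, so it carries a subnormal chain to a
  subnormal chain.\<close>

lemma subnormal_conj:
  assumes "subnormal G H" "g \<in> carrier G"
  shows "subnormal G ((\<lambda>h. g \<otimes> h \<otimes> inv g) ` H)"
  using assms(1)
proof (induction rule: subnormal.induct)
  case subnormal_self
  have "x \<in> (\<lambda>h. g \<otimes> h \<otimes> inv g) ` carrier G" if "x \<in> carrier G" for x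
    using that assms(2) by (intro image_eqI[of _ _ "inv g \<otimes> x \<otimes> g"]) (auto simp: m_assoc)
  then have "(\<lambda>h. g \<otimes> h \<otimes> inv g) ` carrier G = carrier G"
    using assms(2) by auto
  then show ?case by (simp add: subnormal.subnormal_self)
next
  case (subnormal_step K H)
  let ?c = "\<lambda>h. g \<otimes> h \<otimes> inv g"
  have K: "subgroup K G" using subnormal_step by (simp add: subnormal_subgroup)
  have cK: "subgroup (?c ` K) G" using subnormal_step by (simp add: subnormal_subgroup)
  have KG: "K \<subseteq> carrier G" using K by (rule subgroup.subset)
  have "?c \<in> iso (G\<lparr>carrier := K\<rparr>) (G\<lparr>carrier := ?c ` K\<rparr>)"
    using conj_hom[OF assms(2)] inj_on_conj[OF assms(2) KG] KG
    by (auto simp: iso_def hom_def bij_betw_def subset_iff)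
  then have "?c ` H \<lhd> G\<lparr>carrier := ?c ` K\<rparr>"
    using subnormal_step K cK by (intro iso_normal_subgroup) (auto simp: subgroup_imp_group)
  with subnormal_step show ?case by (auto intro: subnormal.subnormal_step)
qed

lemma components_conj:
  assumes "Q \<in> group_components G" "g \<in> carrier G"
  shows "(\<lambda>h. g \<otimes> h \<otimes> inv g) ` Q \<in> group_components G"
proof -
  interpret c: group_hom G G "\<lambda>h. g \<otimes> h \<otimes> inv g"
    by unfold_locales (rule conj_hom[OF assms(2)])
  have "Q \<subseteq> carrier G"
    using assms by (simp add: group_components_def subgroup.subset subnormal_subgroup)
  then show ?thesis
    using assms c.derived_img[of Q] by (simp add: group_components_def subnormal_conj)
qed

text \<open>Conjugation permutes the components and hence preserves the elements centralizing all of
  them.\<close>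

lemma components_centralizer_normal: "centralizer G (\<Union>(group_components G)) \<lhd> G"
proof (rule normal_invI)
  have sub: "\<Union>(group_components G) \<subseteq> carrier G"
    by (auto simp: group_components_def dest!: subnormal_subgroup dest: subgroup.mem_carrier)
  then show "subgroup (centralizer G (\<Union>(group_components G))) G"
    by (rule centralizer_subgroup)
  fix g x assume g: "g \<in> carrier G" and x: "x \<in> centralizer G (\<Union>(group_components G))"
  then have xG: "x \<in> carrier G" by (simp add: centralizer_def)
  have "g \<otimes> x \<otimes> inv g \<otimes> q = q \<otimes> (g \<otimes> x \<otimes> inv g)" if Q: "Q \<in> group_components G" "q \<in> Q" for Q q
  proof -
    have q: "q \<in> carrier G" using Q sub by auto
    \<comment> \<open>That the conjugate of \<open>x\<close> commutes with \<open>q\<close> amounts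
      to \<open>x\<close> commuting with \<open>inv g \<otimes> q \<otimes> g\<close>, which again
      lies in a component.\<close>
    have "inv g \<otimes> q \<otimes> g \<in> \<Union>(group_components G)"
      using components_conj[OF Q(1), of "inv g"] g Q(2) by (auto intro: image_eqI)
    then have *: "x \<otimes> (inv g \<otimes> q \<otimes> g) = inv g \<otimes> q \<otimes> g \<otimes> x"
      using x unfolding centralizer_def by blast
    have "g \<otimes> x \<otimes> inv g \<otimes> q = g \<otimes> (x \<otimes> (inv g \<otimes> q \<otimes> g)) \<otimes> inv g"
      using g xG q by (simp add: m_assoc)
    also have "\<dots> = q \<otimes> (g \<otimes> x \<otimes> inv g)"
      unfolding * using g xG q by (simp add: m_assoc)
    finally show ?thesis .
  qed
  then show "g \<otimes> x \<otimes> inv g \<in> centralizer G (\<Union>(group_components G))"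
    using g xG by (auto simp: centralizer_def)
qed

text \<open>The three subgroups lemma: \<open>a = [s\<inverse>, u]\<close> centralizes both \<open>Q\<close> and its conjugate by \<open>u\<close>, so
conjugation by \<open>u\<close> fixes the commutators of \<open>Q\<close>.\<close>
lemma centralizes_perfect_step:
  assumes K: "subgroup K G" and H: "H \<lhd> G\<lparr>carrier := K\<rparr>" and U: "U \<lhd> G"
    and QH: "Q \<subseteq> H" and QG: "subgroup Q G" and perf: "derived G Q = Q"
    and cent: "U \<inter> H \<subseteq> centralizer G Q"
  shows "U \<inter> K \<subseteq> centralizer G Q"
proof
  fix u assume u: "u \<in> U \<inter> K"
  have H': "subgroup H G" "H \<subseteq> K" "\<And>k h. k \<in> K \<Longrightarrow> h \<in> H \<Longrightarrow> k \<otimes> h \<otimes> inv k \<in> H"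
    using H by (auto simp: normal_restrict_iff[OF K])
  note U' = normal_invE[OF U]
  have uG: "u \<in> carrier G" using subgroup.mem_carrier[OF K] u by auto
  have Q: "q \<in> carrier G" if "q \<in> Q" for q using subgroup.mem_carrier[OF QG that] .
  \<comment> \<open>This commutator is in \<open>U\<close> because \<open>U\<close> is normal, and
    in \<open>H\<close> because \<open>u\<close> lies in \<open>K\<close>, which normalizes
    \<open>H\<close>. By \<open>cent\<close> it therefore centralizes \<open>Q\<close>.\<close>
  have A: "inv s \<otimes> (u \<otimes> s \<otimes> inv u) \<in> U \<inter> H" if "s \<in> Q" for s
  proof
    have "inv s \<otimes> u \<otimes> s \<in> U"
      using U'(2)[of "inv s" u] that Q u by simp
    then have "inv s \<otimes> u \<otimes> s \<otimes> inv u \<in> U"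
      using u U'(1) by (simp add: subgroup.m_closed subgroup.m_inv_closed)
    then show "inv s \<otimes> (u \<otimes> s \<otimes> inv u) \<in> U"
      using Q[OF that] uG by (simp add: m_assoc)
    show "inv s \<otimes> (u \<otimes> s \<otimes> inv u) \<in> H"
      using that u H' QH by (blast intro: subgroup.m_closed subgroup.m_inv_closed)
  qed
  have fix_comm: "u \<otimes> (s \<otimes> t \<otimes> inv s \<otimes> inv t) = s \<otimes> t \<otimes> inv s \<otimes> inv t \<otimes> u"
    if s: "s \<in> Q" and t: "t \<in> Q" for s t
  proof -
    define a where "a = inv s \<otimes> (u \<otimes> s \<otimes> inv u)"
    define b where "b = inv t \<otimes> (u \<otimes> t \<otimes> inv u)"
    have aA: "a \<in> U \<inter> H" and bA: "b \<in> U \<inter> H" using A s t by (auto simp: a_def b_def)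
    have sG: "s \<in> carrier G" and tG: "t \<in> carrier G" using s t Q by auto
    have aG: "a \<in> carrier G" and bG: "b \<in> carrier G" using sG tG uG by (auto simp: a_def b_def)
    have su: "u \<otimes> s \<otimes> inv u = s \<otimes> a" and tu: "u \<otimes> t \<otimes> inv u = t \<otimes> b"
      using sG tG uG by (auto simp: a_def b_def)
    have bs: "b \<otimes> inv s = inv s \<otimes> b"
      using cent bA s QG by (auto simp: centralizer_def dest: subgroup.m_inv_closed)
    \<comment> \<open>Since \<open>u\<close> normalizes both \<open>U\<close> and \<open>H\<close>,
      also \<open>a'\<close> lies in \<open>U \<inter> H\<close> and commutes with \<open>t\<close>.
      Conjugating back by \<open>u\<close>, \<open>a\<close> commutes with the conjugate
      \<open>t \<otimes> b\<close> of \<open>t\<close>.\<close>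
    define a' where "a' = inv u \<otimes> a \<otimes> u"
    have a'G: "a' \<in> carrier G" using aG uG by (simp add: a'_def)
    have "a' \<in> U" using U'(2)[of "inv u" a] aA uG by (simp add: a'_def)
    moreover have "a' \<in> H"
      using H'(3)[of "inv u" a] aA u K uG by (simp add: a'_def subgroup.m_inv_closed)
    ultimately have a't: "a' \<otimes> t = t \<otimes> a'" using cent t by (auto simp: centralizer_def)
    have aeq: "a = u \<otimes> a' \<otimes> inv u" using aG uG by (simp add: a'_def m_assoc)
    have "a \<otimes> (u \<otimes> t \<otimes> inv u) = u \<otimes> (a' \<otimes> t) \<otimes> inv u"
      unfolding aeq using a'G tG uG by (simp add: m_assoc)
    also have "\<dots> = u \<otimes> t \<otimes> inv u \<otimes> a"
      unfolding aeq a't using a'G tG uG by (simp add: m_assoc)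
    finally have atu: "a \<otimes> (t \<otimes> b) = t \<otimes> b \<otimes> a" unfolding tu .
    \<comment> \<open>The conjugate of [s, t] is [s a, t b]. Moving \<open>a\<close> past
      \<open>t \<otimes> b\<close> cancels it against \<open>inv a\<close>; moving \<open>b\<close>
      past \<open>inv s\<close> cancels it against \<open>inv b\<close>.\<close>
    have "u \<otimes> (s \<otimes> t \<otimes> inv s \<otimes> inv t) \<otimes> inv u
        = (u \<otimes> s \<otimes> inv u) \<otimes> (u \<otimes> t \<otimes> inv u) \<otimes> inv (u \<otimes> s \<otimes> inv u) \<otimes> inv (u \<otimes> t \<otimes> inv u)"
      using uG sG tG by (simp add: m_assoc inv_mult_group)
    also have "\<dots> = s \<otimes> (a \<otimes> (t \<otimes> b)) \<otimes> inv a \<otimes> inv s \<otimes> (inv b \<otimes> inv t)"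
      unfolding su tu using aG bG sG tG by (simp add: m_assoc inv_mult_group)
    also have "\<dots> = s \<otimes> t \<otimes> (b \<otimes> inv s) \<otimes> (inv b \<otimes> inv t)"
      unfolding atu using aG bG sG tG by (simp add: m_assoc)
    also have "\<dots> = s \<otimes> t \<otimes> inv s \<otimes> inv t"
      unfolding bs using bG sG tG by (simp add: m_assoc)
    finally show ?thesis using uG sG tG by (simp add: commute_iff_conj)
  qed
  \<comment> \<open>The elements commuting with \<open>u\<close> form a subgroup, so containing the
    commutators of \<open>Q\<close> it contains \<open>derived G Q\<close>, which is
    \<open>Q\<close>.\<close>
  have "subgroup (centralizer G {u}) G" using uG by (simp add: centralizer_subgroup)
  moreover have "derived_set G Q \<subseteq> centralizer G {u}"
    using fix_comm Q by (auto simp: centralizer_def)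
  ultimately have "derived G Q \<subseteq> centralizer G {u}"
    unfolding derived_def by (simp add: generate_subgroup_incl)
  then show "u \<in> centralizer G Q"
    using perf uG by (auto simp: centralizer_def)
qed

text \<open>At \<open>Q\<close> itself the intersection with \<open>U\<close> is trivial;
  \<open>centralizes_perfect_step\<close> then climbs the subnormal chain until the intersection is
  all of \<open>U\<close>.\<close>

lemma normal_centralizes_component:
  assumes Q: "Q \<in> group_components G" and U: "U \<lhd> G" and UQ: "U \<inter> Q \<subseteq> {\<one>}"
  shows "U \<subseteq> centralizer G Q"
proof -
  have QG: "subgroup Q G" and perf: "derived G Q = Q"
    using Q by (auto simp: group_components_def subnormal_subgroup)
  \<comment> \<open>The rules of \<open>subnormal\<close> descend from \<open>G\<close> while the
    argument climbs, so the claim is an implication: for \<open>H\<close> it follows from the one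
    for \<open>K\<close>, whose premise the climbing step supplies.\<close>
  have "U \<subseteq> centralizer G Q" if "subnormal G K" "Q \<subseteq> K" "U \<inter> K \<subseteq> centralizer G Q" for K
    using that
  proof (induction rule: subnormal.induct)
    case subnormal_self
    then show ?case using normal_imp_subgroup[OF U] subgroup.subset by blast
  next
    case (subnormal_step K H)
    have K: "subgroup K G" using subnormal_step by (simp add: subnormal_subgroup)
    then have "H \<subseteq> K" using subnormal_step by (simp add: normal_restrict_iff)
    moreover have "U \<inter> K \<subseteq> centralizer G Q"
      using subnormal_step K U QG perf by (intro centralizes_perfect_step[of K H]) auto
    ultimately show ?case using subnormal_step by blast
  qed
  moreover have "U \<inter> Q \<subseteq> centralizer G Q"
    using UQ subgroup.mem_carrier[OF QG] by (auto simp: centralizer_def)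
  ultimately show ?thesis using Q by (auto simp: group_components_def)
qed

end

section \<open>Normal subgroups of products of simple groups\<close>

text \<open>The derived subgroup is normal, and if it were trivial the group would be
  commutative.\<close>

lemma (in simple_group) derived_carrier_eq:
  assumes "\<not> comm_group G"
  shows "derived G (carrier G) = carrier G"
proof (rule ccontr)
  assume "derived G (carrier G) \<noteq> carrier G"
  then have triv: "derived G (carrier G) = {\<one>}"
    using no_real_normal_subgroup derived_self_is_normal by blast
  have "x \<otimes> y = y \<otimes> x" if "x \<in> carrier G" "y \<in> carrier G" for x y
  proof -
    have "x \<otimes> y \<otimes> inv x \<otimes> inv y \<in> derived G (carrier G)"
      unfolding derived_def using that by (blast intro: generate.incl)
    then have "x \<otimes> y \<otimes> inv x \<otimes> inv y = \<one>" using triv by blast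
    then show ?thesis using that by (simp add: commute_iff_commutator)
  qed
  then show False using assms group_comm_groupI by blast
qed

lemma (in simple_group) center_trivial:
  assumes "\<not> comm_group G" and x: "x \<in> centralizer G (carrier G)"
  shows "x = \<one>"
proof -
  have "centralizer G (carrier G) \<lhd> G"
    by (rule normal_invI) (auto simp: centralizer_subgroup, auto simp: centralizer_def m_assoc)
  moreover have "centralizer G (carrier G) \<noteq> carrier G"
    using assms(1) group_comm_groupI by (auto simp: centralizer_def)
  ultimately show ?thesis using no_real_normal_subgroup x by blast
qed

text \<open>A nontrivial element of \<open>M\<close> has a nontrivial coordinate \<open>j\<close>.
  Its commutators with elements supported at \<open>j\<close> stay in \<open>M\<close> and are
  supported at \<open>j\<close>, so the part of \<open>M\<close> supported at \<open>j\<close> is a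
  nontrivial normal subgroup, which simplicity makes a full copy of \<open>H j\<close>.\<close>

lemma (in group) normal_subgroup_contains_perfect:
  assumes simple: "\<And>i. i \<in> I \<Longrightarrow> simple_group (H i) \<and> finite (carrier (H i)) \<and> \<not> comm_group (H i)"
    and \<pi>: "\<pi> \<in> hom G (product_group I H)"
    and surj: "\<pi> ` carrier G = carrier (product_group I H)"
    and M: "M \<lhd> G" and inj: "inj_on \<pi> M" and ne: "M \<noteq> {\<one>}"
  shows "\<exists>Q\<subseteq>M. Q \<lhd> G \<and> finite Q \<and> derived G Q = Q \<and> Q \<noteq> {\<one>}"
proof -
  have grp: "group (H i)" if "i \<in> I" for i using simple[OF that] simple_group.axioms(1) by blast
  interpret \<pi>: group_hom G "product_group I H" \<pi>
    using \<pi> grp by (auto simp: group_hom_def group_hom_axioms_def is_group)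
  note M' = normal_invE[OF M]
  have MG: "M \<subseteq> carrier G" using M'(1) by (rule subgroup.subset)
  have \<pi>_in: "\<pi> y i \<in> carrier (H i)" if "y \<in> carrier G" "i \<in> I" for y i
    using \<pi>.hom_closed[OF that(1)] that(2) by auto
  have p: "group_hom G (H i) (\<lambda>y. \<pi> y i)" if "i \<in> I" for i
    using grp[OF that] that \<pi>_in
    by (auto simp: group_hom_def group_hom_axioms_def is_group hom_def)
  obtain x where x: "x \<in> M" "x \<noteq> \<one>"
    using ne subgroup.one_closed[OF M'(1)] by blast
  have xG: "x \<in> carrier G" using x MG by auto
  have "\<pi> x \<noteq> \<one>\<^bsub>product_group I H\<^esub>"
    using inj x subgroup.one_closed[OF M'(1)] by (metis \<pi>.hom_one inj_onD)
  moreover have "\<pi> x \<in> extensional I" using \<pi>.hom_closed[OF xG] by (auto simp: PiE_def)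
  ultimately obtain j where j: "j \<in> I" "\<pi> x j \<noteq> \<one>\<^bsub>H j\<^esub>"
    by (force intro: extensionalityI[of _ I])
  define p where "p = (\<lambda>y. \<pi> y j)"
  interpret p: group_hom G "H j" p unfolding p_def by (rule p[OF j(1)])
  interpret Hj: simple_group "H j" using simple[OF j(1)] by simp
  \<comment> \<open>The factor \<open>H j\<close> has trivial center, so some \<open>h\<close> fails
    to commute with the coordinate \<open>p x\<close>.\<close>
  have "p x \<notin> centralizer (H j) (carrier (H j))"
    using Hj.center_trivial simple[OF j(1)] j(2) by (auto simp: p_def)
  then obtain h where h: "h \<in> carrier (H j)" "p x \<otimes>\<^bsub>H j\<^esub> h \<noteq> h \<otimes>\<^bsub>H j\<^esub> p x"
    using xG by (auto simp: centralizer_def)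
  \<comment> \<open>Surjectivity of \<open>\<pi>\<close> realizes each element of the factor
    \<open>H j\<close> by an element of \<open>G\<close> that is trivial in all other
    coordinates.\<close>
  have lift: "\<exists>y\<in>carrier G. p y = k \<and> (\<forall>i\<in>I - {j}. \<pi> y i = \<one>\<^bsub>H i\<^esub>)" if "k \<in> carrier (H j)" for k
  proof -
    have "(\<lambda>i\<in>I. if i = j then k else \<one>\<^bsub>H i\<^esub>) \<in> carrier (product_group I H)"
      using that grp by (auto simp: group.is_monoid monoid.one_closed)
    then obtain y where "y \<in> carrier G" "\<pi> y = (\<lambda>i\<in>I. if i = j then k else \<one>\<^bsub>H i\<^esub>)"
      using surj by (metis (no_types, lifting) imageE)
    then show ?thesis using j(1) by (intro bexI[of _ y]) (auto simp: p_def)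
  qed
  obtain y where y: "y \<in> carrier G" "p y = h" "\<And>i. i \<in> I - {j} \<Longrightarrow> \<pi> y i = \<one>\<^bsub>H i\<^esub>"
    using lift[OF h(1)] by blast
  have surjp: "p ` carrier G = carrier (H j)"
    using lift p.hom_closed by (auto simp: image_iff)
  define Q where "Q = {q \<in> M. \<forall>i\<in>I - {j}. \<pi> q i = \<one>\<^bsub>H i\<^esub>}"
  have QM: "Q \<subseteq> M" by (auto simp: Q_def)
  have Qn: "Q \<lhd> G"
  proof (rule normal_invI)
    show "subgroup Q G"
    proof (rule subgroupI)
      show "Q \<subseteq> carrier G" using QM MG by auto
      have "\<one> \<in> Q"
        using subgroup.one_closed[OF M'(1)] by (auto simp: Q_def)
      then show "Q \<noteq> {}" by blast
    next
      fix a assume a: "a \<in> Q"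
      then have "a \<in> carrier G" using QM MG by auto
      moreover have "\<pi> (inv a) i = \<one>\<^bsub>H i\<^esub>" if i: "i \<in> I - {j}" for i
      proof -
        interpret pi: group_hom G "H i" "\<lambda>y. \<pi> y i" using p i by simp
        show ?thesis using a i \<open>a \<in> carrier G\<close> pi.hom_inv[of a] by (simp add: Q_def)
      qed
      ultimately show "inv a \<in> Q" using a M'(1) by (auto simp: Q_def subgroup.m_inv_closed)
    next
      fix a b assume ab: "a \<in> Q" "b \<in> Q"
      then have "a \<in> carrier G" "b \<in> carrier G" using QM MG by auto
      moreover have "\<pi> (a \<otimes> b) i = \<one>\<^bsub>H i\<^esub>" if i: "i \<in> I - {j}" for i
      proof -
        interpret pi: group_hom G "H i" "\<lambda>y. \<pi> y i" using p i by simp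
        show ?thesis using ab i \<open>a \<in> carrier G\<close> \<open>b \<in> carrier G\<close> pi.hom_mult[of a b]
          by (simp add: Q_def)
      qed
      ultimately show "a \<otimes> b \<in> Q" using ab M'(1) by (auto simp: Q_def subgroup.m_closed)
    qed
    fix g q assume g: "g \<in> carrier G" and q: "q \<in> Q"
    then have qG: "q \<in> carrier G" using QM MG by auto
    have "\<pi> (g \<otimes> q \<otimes> inv g) i = \<one>\<^bsub>H i\<^esub>" if i: "i \<in> I - {j}" for i
    proof -
      interpret pi: group_hom G "H i" "\<lambda>y. \<pi> y i" using p i by simp
      have "\<pi> q i = \<one>\<^bsub>H i\<^esub>" using q i by (simp add: Q_def)
      then show ?thesis
        using g qG pi.hom_mult[of "g \<otimes> q" "inv g"] pi.hom_mult[of g q] pi.hom_inv[of g] by simp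
    qed
    then show "g \<otimes> q \<otimes> inv g \<in> Q" using M'(2) g q by (auto simp: Q_def)
  qed
  have QG: "Q \<subseteq> carrier G" using QM MG by auto
  \<comment> \<open>Elements of \<open>Q\<close> can differ only in coordinate \<open>j\<close>, and
    \<open>\<pi>\<close> is injective on \<open>M\<close>.\<close>
  have injQ: "inj_on p Q"
  proof (rule inj_onI)
    fix a b assume ab: "a \<in> Q" "b \<in> Q" "p a = p b"
    have "\<pi> a i = \<pi> b i" if "i \<in> I" for i
      using ab that by (cases "i = j") (auto simp: Q_def p_def)
    moreover have "\<pi> a \<in> extensional I" "\<pi> b \<in> extensional I"
      using \<pi>.hom_closed ab QG by (auto simp: PiE_def)
    ultimately have "\<pi> a = \<pi> b" by (auto intro: extensionalityI)
    then show "a = b" using inj ab QM by (auto dest: inj_onD)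
  qed
  define c where "c = x \<otimes> y \<otimes> inv x \<otimes> inv y"
  have cG: "c \<in> carrier G" using xG y by (simp add: c_def)
  have "y \<otimes> inv x \<otimes> inv y \<in> M"
    using M'(2)[of y "inv x"] y x M'(1) by (simp add: subgroup.m_inv_closed)
  then have "x \<otimes> (y \<otimes> inv x \<otimes> inv y) \<in> M" using x M'(1) by (simp add: subgroup.m_closed)
  then have cM: "c \<in> M" using xG y by (simp add: c_def m_assoc)
  have "\<pi> c i = \<one>\<^bsub>H i\<^esub>" if i: "i \<in> I - {j}" for i
  proof -
    interpret pi: group_hom G "H i" "\<lambda>y. \<pi> y i" using p i by simp
    show ?thesis unfolding c_def
      using xG y(1) y(3)[OF i] i pi.hom_mult pi.hom_inv by simp
  qed
  with cM have cQ: "c \<in> Q" by (simp add: Q_def)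
  have "p c = p x \<otimes>\<^bsub>H j\<^esub> h \<otimes>\<^bsub>H j\<^esub> inv\<^bsub>H j\<^esub> p x \<otimes>\<^bsub>H j\<^esub> inv\<^bsub>H j\<^esub> h"
    unfolding c_def using xG y by simp
  then have pc: "p c \<noteq> \<one>\<^bsub>H j\<^esub>"
    using h xG by (simp add: p.H.commute_iff_commutator)
  have "p ` Q \<lhd> H j"
    using normal.surj_hom_normal_subgroup[OF Qn p.group_hom_axioms surjp] .
  moreover have "p ` Q \<noteq> {\<one>\<^bsub>H j\<^esub>}" using pc cQ by blast
  ultimately have pQ: "p ` Q = carrier (H j)" using Hj.no_real_normal_subgroup by blast
  have "finite Q" using pQ injQ simple[OF j(1)] by (metis finite_imageD)
  \<comment> \<open>Both sides have image \<open>carrier (H j)\<close> under \<open>p\<close>, since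
    \<open>H j\<close> is perfect; injectivity of \<open>p\<close> on \<open>Q\<close> gives
    equality.\<close>
  moreover have "derived G Q = Q"
  proof (rule inj_on_image_eq_iff[THEN iffD1])
    show "inj_on p Q" by (rule injQ)
    show "derived G Q \<subseteq> Q" using derived_incl[of Q Q] normal_imp_subgroup[OF Qn] by simp
    show "p ` derived G Q = p ` Q"
      using p.derived_img[OF QG] Hj.derived_carrier_eq simple[OF j(1)] pQ by simp
  qed simp
  moreover have "Q \<noteq> {\<one>}" using cQ pc by auto
  ultimately show ?thesis using QM Qn by blast
qed

section \<open>Groups of finite semisimple length\<close>

text \<open>The centralizer meets \<open>N\<close> trivially, so its part in \<open>K\<close> embeds
  into the semisimple quotient. If nontrivial, that part would contain a nontrivial component, which
  would be both perfect and abelian.\<close>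

lemma (in group) components_centralizer_layer:
  assumes K: "subnormal G K" and N: "N \<lhd> G\<lparr>carrier := K\<rparr>"
    and ss: "semisimple_profinite (G\<lparr>carrier := K\<rparr> Mod N) Z"
    and triv: "centralizer G (\<Union>(group_components G)) \<inter> N \<subseteq> {\<one>}"
  shows "centralizer G (\<Union>(group_components G)) \<inter> K \<subseteq> {\<one>}"
proof -
  define C where "C = centralizer G (\<Union>(group_components G))"
  have KG: "subgroup K G" using K by (rule subnormal_subgroup)
  interpret K: group "G\<lparr>carrier := K\<rparr>" using KG by (rule subgroup_imp_group)
  interpret N: normal N "G\<lparr>carrier := K\<rparr>" by (rule N)
  have Csub: "subgroup C G" using components_centralizer_normal normal_imp_subgroup by (simp add: C_def)
  obtain I :: "'a set set" and H :: "'a set \<Rightarrow> nat monoid" and f where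
    simple: "\<And>i. i \<in> I \<Longrightarrow> simple_group (H i) \<and> finite (carrier (H i)) \<and> \<not> comm_group (H i)"
    and f: "f \<in> iso (G\<lparr>carrier := K\<rparr> Mod N) (product_group I H)"
    using ss unfolding semisimple_profinite_def by blast
  \<comment> \<open>The projection of \<open>K\<close> onto its quotient by \<open>N\<close>,
    followed by the isomorphism to the product.\<close>
  define \<pi> where "\<pi> = f \<circ> (\<lambda>a. N #>\<^bsub>G\<lparr>carrier := K\<rparr>\<^esub> a)"
  have \<pi>: "\<pi> \<in> hom (G\<lparr>carrier := K\<rparr>) (product_group I H)"
    unfolding \<pi>_def by (rule Group.hom_compose[OF N.r_coset_hom_Mod]) (use f in \<open>simp add: iso_def\<close>)
  have "(\<lambda>a. N #>\<^bsub>G\<lparr>carrier := K\<rparr>\<^esub> a) ` K = carrier (G\<lparr>carrier := K\<rparr> Mod N)"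
    by (auto simp: FactGroup_def RCOSETS_def)
  then have surj: "\<pi> ` carrier (G\<lparr>carrier := K\<rparr>) = carrier (product_group I H)"
    using f by (simp add: \<pi>_def iso_def bij_betw_def flip: image_image)
  have M: "C \<inter> K \<lhd> G\<lparr>carrier := K\<rparr>"
    using components_centralizer_normal KG Csub subgroup.mem_carrier[OF KG]
    by (auto simp: normal_restrict_iff normal_inv_iff C_def subgroups_Inter_pair
        intro: subgroup.m_closed subgroup.m_inv_closed)
  have inj: "inj_on \<pi> (C \<inter> K)"
  proof (rule inj_onI)
    fix a b assume ab: "a \<in> C \<inter> K" "b \<in> C \<inter> K" "\<pi> a = \<pi> b"
    have "N #>\<^bsub>G\<lparr>carrier := K\<rparr>\<^esub> a = N #>\<^bsub>G\<lparr>carrier := K\<rparr>\<^esub> b"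
      using ab f by (auto simp: \<pi>_def iso_def bij_betw_def FactGroup_def RCOSETS_def dest: inj_onD)
    then have "a \<in> N #>\<^bsub>G\<lparr>carrier := K\<rparr>\<^esub> b"
      using ab K.rcos_self[OF _ N.subgroup_axioms, of a] by simp
    then obtain n where n: "n \<in> N" "a = n \<otimes> b" by (auto simp: r_coset_def)
    have abG: "a \<in> carrier G" "b \<in> carrier G" "n \<in> carrier G"
      using ab n Csub N.subset subgroup.mem_carrier[OF KG] by auto
    then have "a \<otimes> inv b = n" using n by (simp add: m_assoc)
    moreover have "a \<otimes> inv b \<in> C" using ab Csub by (simp add: subgroup.m_closed subgroup.m_inv_closed)
    ultimately have "n = \<one>" using triv n by (auto simp: C_def)
    then show "a = b" using n abG by simp
  qed
  have "C \<inter> K = {\<one>}"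
  proof (rule ccontr)
    assume "C \<inter> K \<noteq> {\<one>}"
    then obtain Q where Q: "Q \<subseteq> C \<inter> K" "Q \<lhd> G\<lparr>carrier := K\<rparr>" "finite Q"
        "derived (G\<lparr>carrier := K\<rparr>) Q = Q" "Q \<noteq> {\<one>}"
      using K.normal_subgroup_contains_perfect[OF simple \<pi> surj M inj] by auto
    have QG: "subgroup Q G" using Q(2) KG by (simp add: normal_restrict_iff)
    have perf: "derived G Q = Q" using Q derived_consistent[of Q K] KG by simp
    have "Q \<in> group_components G"
      using Q perf K by (auto simp: group_components_def intro: subnormal_step)
    \<comment> \<open>so \<open>Q\<close> centralizes itself, being contained in \<open>C\<close>\<close>
    then have comm: "a \<otimes> b = b \<otimes> a" if "a \<in> Q" "b \<in> Q" for a b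
      using that Q(1) by (auto simp: C_def centralizer_def)
    have "derived_set G Q \<subseteq> {\<one>}"
    proof clarsimp
      fix a b assume ab: "a \<in> Q" "b \<in> Q"
      then have "a \<in> carrier G" "b \<in> carrier G" using subgroup.mem_carrier[OF QG] by auto
      then show "a \<otimes> b \<otimes> inv a \<otimes> inv b = \<one>"
        using comm[OF ab] by (simp add: commute_iff_commutator)
    qed
    then have "derived G Q \<subseteq> {\<one>}"
      unfolding derived_def by (intro generate_subgroup_incl triv_subgroup)
    then show False using perf Q(5) subgroup.one_closed[OF QG] by auto
  qed
  then show ?thesis by (simp add: C_def)
qed

text \<open>Backward induction along the series: the intersection is trivial at \<open>S n\<close>,
  and each layer passes this from \<open>S (Suc i)\<close> to \<open>S i\<close>, up to the whole
  group \<open>S 0\<close>.\<close>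

lemma (in group) components_centralizer_trivial:
  assumes "finite_semisimple_length G T"
  shows "centralizer G (\<Union>(group_components G)) = {\<one>}"
proof -
  obtain n S where S0: "S 0 = carrier G" and Sn: "S n = {\<one>}"
    and N: "\<And>i. i < n \<Longrightarrow> S (Suc i) \<lhd> G\<lparr>carrier := S i\<rparr>"
    and ss: "\<And>i. i < n \<Longrightarrow> semisimple_profinite (G\<lparr>carrier := S i\<rparr> Mod S (Suc i))
          (coset_quotient_topology (G\<lparr>carrier := S i\<rparr>) (S (Suc i)) (subtopology T (S i)))"
    using assms unfolding finite_semisimple_length_def by blast
  have sub: "subnormal G (S i)" if "i \<le> n" for i
    using that
  proof (induction i)
    case 0
    then show ?case by (simp add: S0 subnormal_self)
  next
    case (Suc i)
    then show ?case using N[of i] by (auto intro: subnormal_step)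
  qed
  have "centralizer G (\<Union>(group_components G)) \<inter> S 0 \<subseteq> {\<one>}"
  proof (rule inc_induct[of 0 n])
    fix i assume i: "0 \<le> i" "i < n" and "centralizer G (\<Union>(group_components G)) \<inter> S (Suc i) \<subseteq> {\<one>}"
    then show "centralizer G (\<Union>(group_components G)) \<inter> S i \<subseteq> {\<one>}"
      using components_centralizer_layer[OF sub N ss] by simp
  qed (auto simp: Sn)
  moreover have "subgroup (centralizer G (\<Union>(group_components G))) G"
    using components_centralizer_normal normal_imp_subgroup by blast
  ultimately show ?thesis
    using S0 subgroup.subset subgroup.one_closed by blast
qed

section \<open>Profinite topologies\<close>

text \<open>In a compact Hausdorff space, points that no clopen set separates lie in one connected
  component, and here components are single points.\<close>

lemma totally_disconnected_clopen_separation: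
  assumes "compact_space Z" "Hausdorff_space Z" "totally_disconnected_space Z"
    and x: "x \<in> topspace Z" and y: "y \<in> topspace Z" and "x \<noteq> y"
  shows "\<exists>V. openin Z V \<and> closedin Z V \<and> x \<in> V \<and> y \<notin> V"
proof (rule ccontr)
  assume no: "\<not> ?thesis"
  then have "quasi_component_of Z x y" using x y by (auto simp: quasi_component_of)
  moreover have "quasi_components_of Z = connected_components_of Z"
    using assms by (intro quasi_eq_connected_components_of) blast
  ultimately have "connected_component_of Z x y"
    by (simp add: quasi_eq_connected_components_of_pointwise_alt)
  then obtain S where "connectedin Z S" "x \<in> S" "y \<in> S"
    by (auto simp: connected_component_of_def)
  then show False using assms(3,6) unfolding totally_disconnected_space_def by blast
qed

section \<open>Open and clopen cosets in topological groups\<close>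

lemma continuous_map_group_mult:
  assumes "topological_group G T" "continuous_map Z T f" "continuous_map Z T g"
  shows "continuous_map Z T (\<lambda>x. f x \<otimes>\<^bsub>G\<^esub> g x)"
proof -
  have "continuous_map Z T ((\<lambda>(x, y). x \<otimes>\<^bsub>G\<^esub> y) \<circ> (\<lambda>x. (f x, g x)))"
    using assms unfolding topological_group_def
    by (intro continuous_map_compose[of Z "prod_topology T T"]) (auto simp: continuous_map_pairwise o_def)
  then show ?thesis by (simp add: o_def)
qed

text \<open>The set is the left coset of \<open>H\<close> by \<open>g\<close>. Around each of its
  points \<open>x\<close>, the translate of \<open>W\<close> by \<open>x\<close> is an open
  neighbourhood inside the coset.\<close>

lemma subgroup_openin:
  fixes G :: "('a, 'c) monoid_scheme" (structure)
  assumes tg: "topological_group G T" and H: "subgroup H G"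
    and W: "openin T W" "\<one> \<in> W" "W \<subseteq> H"
    and g: "g \<in> carrier G"
  shows "openin T {x \<in> carrier G. inv g \<otimes> x \<in> H}"
proof (subst openin_subopen, clarify)
  interpret group G using tg by (simp add: topological_group_def)
  have top: "topspace T = carrier G" using tg by (simp add: topological_group_def)
  fix x assume x: "x \<in> carrier G" "inv g \<otimes> x \<in> H"
  define V where "V = {y \<in> carrier G. inv x \<otimes> y \<in> W}"
  have "continuous_map T T (\<lambda>y. inv x \<otimes> y)"
    using tg x by (intro continuous_map_group_mult) (auto simp: top)
  from openin_continuous_map_preimage[OF this W(1)] have "openin T V"
    by (simp add: V_def top)
  moreover have "x \<in> V" using x W by (simp add: V_def)
  moreover have "V \<subseteq> {x \<in> carrier G. inv g \<otimes> x \<in> H}"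
  proof clarify
    fix y assume "y \<in> V"
    then have y: "y \<in> carrier G" "inv x \<otimes> y \<in> H" using W by (auto simp: V_def)
    have "(inv g \<otimes> x) \<otimes> (inv x \<otimes> y) \<in> H" using x y H by (simp add: subgroup.m_closed)
    then show "y \<in> carrier G \<and> inv g \<otimes> y \<in> H" using x y g by (simp add: m_assoc)
  qed
  ultimately show "\<exists>V. openin T V \<and> x \<in> V \<and> V \<subseteq> {x \<in> carrier G. inv g \<otimes> x \<in> H}" by blast
qed

text \<open>The normal subgroup consists of those \<open>u\<close> for which inserting \<open>u\<close> anywhere into a product
does not change its membership in the clopen set \<open>V\<close>.\<close>
lemma clopen_contains_open_normal:
  fixes G :: "('a, 'c) monoid_scheme" (structure)
  assumes tg: "topological_group G T" and "compact_space T"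
    and V: "openin T V" "closedin T V" "\<one> \<in> V"
  shows "\<exists>U W. U \<lhd> G \<and> U \<subseteq> V \<and> openin T W \<and> \<one> \<in> W \<and> W \<subseteq> U"
proof -
  interpret group G using tg by (simp add: topological_group_def)
  have top: "topspace T = carrier G" using tg by (simp add: topological_group_def)
  define U where "U = {u \<in> carrier G. \<forall>x\<in>carrier G. \<forall>y\<in>carrier G. x \<otimes> u \<otimes> y \<in> V \<longleftrightarrow> x \<otimes> y \<in> V}"
  have UD: "x \<otimes> u \<otimes> y \<in> V \<longleftrightarrow> x \<otimes> y \<in> V"
    if "u \<in> U" "x \<in> carrier G" "y \<in> carrier G" for u x y
    using that by (simp add: U_def)
  have UG: "U \<subseteq> carrier G" by (auto simp: U_def)
  have "U \<lhd> G"
  proof (rule normal_invI)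
    show "subgroup U G"
    proof (rule subgroupI)
      show "U \<noteq> {}" by (auto simp: U_def intro!: exI[of _ \<one>])
    next
      fix u assume u: "u \<in> U"
      then have uG: "u \<in> carrier G" using UG by auto
      have "x \<otimes> inv u \<otimes> y \<in> V \<longleftrightarrow> x \<otimes> y \<in> V" if "x \<in> carrier G" "y \<in> carrier G" for x y
        using UD[OF u, of "x \<otimes> inv u" y] uG that by (simp add: m_assoc)
      then show "inv u \<in> U" using uG by (simp add: U_def)
    next
      fix u v assume u: "u \<in> U" and v: "v \<in> U"
      then have uG: "u \<in> carrier G" "v \<in> carrier G" using UG by auto
      have "x \<otimes> (u \<otimes> v) \<otimes> y \<in> V \<longleftrightarrow> x \<otimes> y \<in> V" if "x \<in> carrier G" "y \<in> carrier G" for x y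
        using UD[OF u, of x "v \<otimes> y"] UD[OF v, of x y] uG that by (simp add: m_assoc)
      then show "u \<otimes> v \<in> U" using uG by (simp add: U_def)
    qed (rule UG)
    fix g u assume g: "g \<in> carrier G" and u: "u \<in> U"
    then have uG: "u \<in> carrier G" using UG by auto
    have "x \<otimes> (g \<otimes> u \<otimes> inv g) \<otimes> y \<in> V \<longleftrightarrow> x \<otimes> y \<in> V" if "x \<in> carrier G" "y \<in> carrier G" for x y
      using UD[OF u, of "x \<otimes> g" "inv g \<otimes> y"] uG g that by (simp add: m_assoc)
    then show "g \<otimes> u \<otimes> inv g \<in> U" using uG g by (simp add: U_def)
  qed
  moreover have "U \<subseteq> V"
  proof
    fix u assume "u \<in> U"
    then show "u \<in> V" using UD[of u \<one> \<one>] UG V(3) by auto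
  qed
  moreover have "\<exists>W. openin T W \<and> \<one> \<in> W \<and> W \<subseteq> U"
  proof -
    define P where "P = prod_topology T T"
    define XX where "XX = prod_topology P T"
    \<comment> \<open>On triples ((x, y), u), \<open>f\<close> inserts \<open>u\<close> between
      \<open>x\<close> and \<open>y\<close>, while \<open>g\<close> omits it. Below,
      \<open>A \<union> B\<close> is the set where both products agree on membership in
      \<open>V\<close>; it is open because \<open>V\<close> is clopen.\<close>
    define f where "f = (\<lambda>z. fst (fst z) \<otimes> snd z \<otimes> snd (fst z))"
    define g where "g = (\<lambda>z::('a \<times> 'a) \<times> 'a. fst (fst z) \<otimes> snd (fst z))"
    have c1: "continuous_map XX T (\<lambda>z. fst (fst z))" "continuous_map XX T (\<lambda>z. snd (fst z))"
        "continuous_map XX T snd"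
      unfolding XX_def P_def
      using continuous_map_compose[OF continuous_map_fst continuous_map_fst]
        continuous_map_compose[OF continuous_map_fst continuous_map_snd] continuous_map_snd
      by (auto simp: o_def)
    have cf: "continuous_map XX T f" and cg: "continuous_map XX T g"
      unfolding f_def g_def by (intro continuous_map_group_mult[OF tg] c1)+
    define A where "A = {z \<in> topspace XX. f z \<in> V} \<inter> {z \<in> topspace XX. g z \<in> V}"
    define B where "B = {z \<in> topspace XX. f z \<in> topspace T - V} \<inter> {z \<in> topspace XX. g z \<in> topspace T - V}"
    have "openin XX (A \<union> B)"
      unfolding A_def B_def using cf cg V
      by (intro openin_Un openin_Int openin_continuous_map_preimage) auto
    moreover have "compactin P (topspace P)"
      using assms(2) compact_space_prod_topology[of T T]
      by (simp add: P_def compact_space_def)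
    \<comment> \<open>At the unit the two products coincide. Compactness of the space of pairs (x,
      y) then yields, by the tube lemma, one neighbourhood \<open>W\<close> that works for all
      pairs.\<close>
    moreover have "topspace P \<times> {\<one>} \<subseteq> A \<union> B"
      by (auto simp: A_def B_def f_def g_def XX_def P_def top)
    ultimately obtain Y W where YW: "openin T W" "topspace P \<subseteq> Y" "\<one> \<in> W" "Y \<times> W \<subseteq> A \<union> B"
      using tube_lemma_left[of P T "A \<union> B" "topspace P" \<one>] by (auto simp: XX_def top)
    have "W \<subseteq> U"
    proof
      fix w assume w: "w \<in> W"
      have wG: "w \<in> carrier G" using w YW(1) openin_subset top by blast
      have "x \<otimes> w \<otimes> y \<in> V \<longleftrightarrow> x \<otimes> y \<in> V" if "x \<in> carrier G" "y \<in> carrier G" for x y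
      proof -
        have "((x, y), w) \<in> A \<union> B" using YW(2,4) w that by (auto simp: P_def top)
        then show ?thesis by (auto simp: A_def B_def f_def g_def)
      qed
      then show "w \<in> U" using wG by (simp add: U_def)
    qed
    then show ?thesis using YW by blast
  qed
  ultimately show ?thesis by blast
qed

text \<open>A clopen neighbourhood of the unit avoids the finitely many other elements of
  \<open>Q\<close>. The normal subgroup found inside it meets \<open>Q\<close> trivially, hence
  centralizes \<open>Q\<close>, so the centralizer contains an open neighbourhood of the
  unit.\<close>

lemma component_centralizer_coset_clopen:
  fixes G :: "('a, 'c) monoid_scheme" (structure)
  assumes pf: "profinite_group G T" and Q: "Q \<in> group_components G" and g: "g \<in> carrier G"
  defines "D \<equiv> {x \<in> carrier G. inv g \<otimes> x \<in> centralizer G Q}"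
  shows "openin T D" "closedin T D"
proof -
  have tg: "topological_group G T" using pf by (simp add: profinite_group_def)
  interpret group G using tg by (simp add: topological_group_def)
  have top: "topspace T = carrier G" using tg by (simp add: topological_group_def)
  have QG: "Q \<subseteq> carrier G" and fin: "finite Q"
    using Q by (auto simp: group_components_def dest!: subnormal_subgroup dest: subgroup.mem_carrier)
  have "\<exists>V. openin T V \<and> closedin T V \<and> \<one> \<in> V \<and> q \<notin> V" if "q \<in> Q - {\<one>}" for q
    using that QG pf top
    by (intro totally_disconnected_clopen_separation) (auto simp: profinite_group_def)
  then obtain V where V: "\<And>q. q \<in> Q - {\<one>} \<Longrightarrow> openin T (V q) \<and> closedin T (V q) \<and> \<one> \<in> V q \<and> q \<notin> V q"
    by metis
  \<comment> \<open>Finiteness of \<open>Q\<close> keeps the intersection open; the factor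
    \<open>topspace T\<close> covers trivial \<open>Q\<close>, where the family is empty.\<close>
  define V' where "V' = topspace T \<inter> \<Inter>(V ` (Q - {\<one>}))"
  have "openin T V'" unfolding V'_def
    using V fin by (intro openin_Int_Inter) auto
  moreover have "closedin T V'"
    unfolding V'_def Inter_insert[symmetric] using V by (intro closedin_Inter) auto
  moreover have "\<one> \<in> V'" using V by (auto simp: V'_def top)
  ultimately obtain U W where U: "U \<lhd> G" "U \<subseteq> V'" "openin T W" "\<one> \<in> W" "W \<subseteq> U"
    using clopen_contains_open_normal[OF tg, of V'] pf unfolding profinite_group_def by blast
  have "U \<inter> Q \<subseteq> {\<one>}" using U(2) V by (auto simp: V'_def)
  then have "W \<subseteq> centralizer G Q" using normal_centralizes_component[OF Q U(1)] U(5) by blast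
  then have op: "openin T {x \<in> carrier G. inv h \<otimes> x \<in> centralizer G Q}" if "h \<in> carrier G" for h
    using U that centralizer_subgroup[OF QG] by (intro subgroup_openin[OF tg]) auto
  then show "openin T D" using g by (simp add: D_def)
  have sub: "subgroup (centralizer G Q) G" by (rule centralizer_subgroup[OF QG])
  \<comment> \<open>The complement of a coset is a union of other cosets of the same subgroup, all
    of them open.\<close>
  have "openin T (topspace T - D)"
  proof (subst openin_subopen, clarify)
    fix h assume h: "h \<in> topspace T" "h \<notin> D"
    have hG: "h \<in> carrier G" using h by (simp add: top)
    have "x \<notin> D" if x: "x \<in> carrier G" "inv h \<otimes> x \<in> centralizer G Q" for x
    proof
      assume "x \<in> D"
      then have "inv g \<otimes> x \<in> centralizer G Q" by (simp add: D_def)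
      moreover have "inv (inv h \<otimes> x) \<in> centralizer G Q"
        using x sub by (intro subgroup.m_inv_closed)
      ultimately have "(inv g \<otimes> x) \<otimes> inv (inv h \<otimes> x) \<in> centralizer G Q"
        by (rule subgroup.m_closed[OF sub])
      then have "inv g \<otimes> h \<in> centralizer G Q"
        using x hG g by (simp add: inv_mult_group m_assoc)
      then show False using h hG by (simp add: D_def)
    qed
    then show "\<exists>W. openin T W \<and> h \<in> W \<and> W \<subseteq> topspace T - D"
      using op[OF hG] hG subgroup.one_closed[OF sub]
      by (intro exI[of _ "{x \<in> carrier G. inv h \<otimes> x \<in> centralizer G Q}"]) (auto simp: top)
  qed
  then show "closedin T D" by (simp add: closedin_def D_def top)
qed

text \<open>For \<open>x\<close> in \<open>W\<close>, the sets \<open>D\<close> containing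
  \<open>x\<close> separate it from every point of the compact complement of \<open>W\<close>.
  Finitely many of them already have intersection inside \<open>W\<close>, and that intersection is
  open in \<open>T\<close>.\<close>

lemma compact_topology_open_transfer:
  assumes "compact_space S" and top: "topspace S = topspace T" and W: "openin S W"
    and sep: "\<And>x y. \<lbrakk>x \<in> topspace S; y \<in> topspace S; x \<noteq> y\<rbrakk>
      \<Longrightarrow> \<exists>D. closedin S D \<and> openin T D \<and> x \<in> D \<and> y \<notin> D"
  shows "openin T W"
proof (subst openin_subopen, clarify)
  fix x assume x: "x \<in> W"
  have xS: "x \<in> topspace S" using x W openin_subset by blast
  define \<D> where "\<D> = {D. closedin S D \<and> openin T D \<and> x \<in> D}"
  have "compactin S (topspace S - W)"
    using assms(1) W by (intro closedin_compact_space closedin_diff) auto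
  moreover have "\<forall>U\<in>(\<lambda>D. topspace S - D) ` \<D>. openin S U" by (auto simp: \<D>_def)
  moreover have "topspace S - W \<subseteq> \<Union>((\<lambda>D. topspace S - D) ` \<D>)"
    using sep[OF xS] x by (fastforce simp: \<D>_def)
  ultimately obtain \<F> where \<F>: "finite \<F>" "\<F> \<subseteq> (\<lambda>D. topspace S - D) ` \<D>" "topspace S - W \<subseteq> \<Union>\<F>"
    unfolding compactin_def by meson
  then obtain \<E> where \<E>: "finite \<E>" "\<E> \<subseteq> \<D>" "\<F> = (\<lambda>D. topspace S - D) ` \<E>"
    by (meson finite_subset_image)
  have "openin T (topspace T \<inter> \<Inter>\<E>)"
    using \<E> by (intro openin_Int_Inter) (auto simp: \<D>_def)
  moreover have "x \<in> topspace T \<inter> \<Inter>\<E>" using \<E> xS top by (auto simp: \<D>_def)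
  moreover have "topspace T \<inter> \<Inter>\<E> \<subseteq> W" using \<F>(3) \<E>(3) top by auto
  ultimately show "\<exists>V. openin T V \<and> x \<in> V \<and> V \<subseteq> W" by blast
qed

theorem mainTheorem12:
  fixes G :: "('g, 'c) monoid_scheme" and T :: "'g topology"
  assumes "profinite_group G T"
    and "finite_semisimple_length G T"
  shows "profinitely_rigid G"
  unfolding profinitely_rigid_def
proof (rule ex1I)
  show "profinite_group G T" by (rule assms(1))
  fix T' assume T': "profinite_group G T'"
  interpret group G using assms(1) by (simp add: profinite_group_def topological_group_def)
  have triv: "centralizer G (\<Union>(group_components G)) = {\<one>\<^bsub>G\<^esub>}"
    by (rule components_centralizer_trivial[OF assms(2)])
  \<comment> \<open>Stated for an arbitrary pair of profinite topologies, so that exchanging them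
    gives both inclusions between \<open>T\<close> and \<open>T'\<close>.\<close>
  have "openin T2 W" if T1: "profinite_group G T1" and T2: "profinite_group G T2" and W: "openin T1 W"
    for T1 T2 W
  proof (rule compact_topology_open_transfer)
    show "compact_space T1" using T1 by (simp add: profinite_group_def)
    show "topspace T1 = topspace T2"
      using T1 T2 by (simp add: profinite_group_def topological_group_def)
    show "openin T1 W" by (rule W)
    fix x y assume "x \<in> topspace T1" "y \<in> topspace T1" and ne: "x \<noteq> y"
    then have x: "x \<in> carrier G" and y: "y \<in> carrier G"
      using T1 by (auto simp: profinite_group_def topological_group_def)
    have "inv\<^bsub>G\<^esub> x \<otimes>\<^bsub>G\<^esub> y \<noteq> \<one>\<^bsub>G\<^esub>"
      using inv_mult_cancel_left(2)[OF x y] x ne by auto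
    then have "inv\<^bsub>G\<^esub> x \<otimes>\<^bsub>G\<^esub> y \<notin> centralizer G (\<Union>(group_components G))" using triv by simp
    \<comment> \<open>As \<open>Q\<close> is not centralized by this quotient, \<open>y\<close> lies
      outside the coset of \<open>centralizer G Q\<close> through \<open>x\<close>; that coset is
      clopen in both topologies because components are defined without a topology.\<close>
    then obtain Q where Q: "Q \<in> group_components G" "inv\<^bsub>G\<^esub> x \<otimes>\<^bsub>G\<^esub> y \<notin> centralizer G Q"
      using x y by (auto simp: centralizer_def)
    have "Q \<subseteq> carrier G"
      using Q by (simp add: group_components_def subgroup.subset subnormal_subgroup)
    then have "\<one>\<^bsub>G\<^esub> \<in> centralizer G Q"
      by (auto simp: centralizer_def)
    then show "\<exists>D. closedin T1 D \<and> openin T2 D \<and> x \<in> D \<and> y \<notin> D"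
      using component_centralizer_coset_clopen(2)[OF T1 Q(1) x]
        component_centralizer_coset_clopen(1)[OF T2 Q(1) x] x Q(2)
      by (intro exI[of _ "{z \<in> carrier G. inv\<^bsub>G\<^esub> x \<otimes>\<^bsub>G\<^esub> z \<in> centralizer G Q}"]) simp
  qed
  from this[OF T' assms(1)] this[OF assms(1) T'] show "T' = T"
    unfolding topology_eq by blast
qed

end
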